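(* Let $n\in\mathbb{N}$ and $s\in\mathbb{C}\setminus\{-1,-2,-3,\dots\}$. Then \[ \sum_{k=1}^{n}\binom{s+n}{k}\frac{(-1)^{k-1}}{k^2}=\frac{H_n^2+H_n^{(2)}}{2}+s\sum_{k=0}^{n-1}\frac{(-1)^k}{k+1}\binom{s+k}{k}\frac{H_n-H_k}{(n-k)\binom{n}{k}}. \]
   Context: For $m\in\mathbb{N}_0$, $H_m^{(r)}=\sum_{j=1}^{m}\frac{1}{j^r}$ (with $H_0^{(r)}=0$) and $H_m=H_m^{(1)}$. For $z\in\mathbb{C}$ and $k\in\mathbb{N}_0$, $\binom{z}{k}=\frac{z(z-1)\cdots(z-k+1)}{k!}$. *)

theory Defs
  imports "HOL-Analysis.Harmonic_Numbers"
begin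

text \<open>The generalized harmonic number \<open>H\<^sub>m\<^sup>(\<^sup>r\<^sup>)\<close>; for \<open>r = 1\<close> it is the library's \<open>harm m\<close>.\<close>

definition gen_harm :: "nat \<Rightarrow> nat \<Rightarrow> 'a :: real_normed_field" where
  "gen_harm r m = (\<Sum>j=1..m. 1 / of_nat j ^ r)"

lemma gen_harm_1: "gen_harm 1 m = harm m"
  by (simp add: gen_harm_def harm_def inverse_eq_divide)

end

theory Submission
  imports Defs "HOL-Computational_Algebra.Polynomial"
begin

text \<open>
  With \<open>p = -s\<close>, the right-hand side becomes \<open>G n - (\<Sum>k<n. (p gchoose (k+1)) * w n k)\<close>, where
  \<open>G n = (H\<^sub>n\<^sup>2 + H\<^sub>n\<^sup>(\<^sup>2\<^sup>)) / 2\<close> and \<open>w n k = (H\<^sub>n - H\<^sub>k) / ((n - k) * (n choose k))\<close>. Both sides are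
  polynomials in \<open>p\<close> of degree at most \<open>n\<close>, so it suffices to compare them at \<open>p = 0, \<dots>, n\<close>. There
  the left-hand side is \<open>G (n - p)\<close>, and the increment in \<open>p\<close> of the right-hand side is found from the
  Pascal-type rule \<open>w (n+1) k + w (n+1) (k+1) = w n k\<close>, which reflects
  \<open>w n k = - \<integral>\<^sub>0\<^sup>1 u\<^sup>k (1-u)\<^sup>n\<^sup>-\<^sup>k\<^sup>-\<^sup>1 ln u du\<close>.
\<close>

text \<open>The full alternating sum of row \<open>N \<ge> 1\<close> vanishes, and its term of index
  0 is 1. The bound \<open>K\<close> is free because terms beyond the row are zero; inductions on
  \<open>N\<close> can then keep the range fixed.\<close>

lemma alternating_sum_binomial_Suc:
  assumes "1 \<le> N" "N \<le> K"
  shows "(\<Sum>k<K. of_nat (N choose Suc k) * (-1) ^ k) = (1 :: 'a :: comm_ring_1)"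
proof -
  have "0 = (\<Sum>i\<le>N. (-1) ^ i * of_nat (N choose i) :: 'a)"
    using assms by (simp add: choose_alternating_sum)
  also have "\<dots> = (\<Sum>i\<le>K. (-1) ^ i * of_nat (N choose i))"
    using assms by (intro sum.mono_neutral_left) (auto simp: binomial_eq_0)
  also have "\<dots> = 1 - (\<Sum>k<K. of_nat (N choose Suc k) * (-1) ^ k)"
    by (simp add: sum.atMost_shift sum_negf mult.commute)
  finally show ?thesis by simp
qed

lemma binomial_div_absorb:
  "(of_nat (N choose k) / of_nat (Suc k) :: 'a :: field_char_0) =
     of_nat (Suc N choose Suc k) / of_nat (Suc N)"
proof -
  have "of_nat (Suc k * (Suc N choose Suc k)) = (of_nat (Suc N * (N choose k)) :: 'a)"
    using Suc_times_binomial by metis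
  then show ?thesis
    unfolding of_nat_mult by (simp add: frac_eq_eq mult.commute del: of_nat_Suc binomial_Suc_Suc)
qed

text \<open>Induction by Pascal's rule: absorption turns the additional terms into an alternating
  row sum over \<open>Suc N\<close>, that is \<open>1 / Suc N\<close>.\<close>

lemma alternating_sum_binomial_div:
  assumes "N \<le> K"
  shows "(\<Sum>k<K. of_nat (N choose Suc k) * (-1) ^ k / of_nat (Suc k)) =
           (harm N :: 'a :: real_normed_field)"
  using assms
proof (induction N)
  case 0
  then show ?case by (simp add: harm_def)
next
  case (Suc N)
  have "(\<Sum>k<K. of_nat (Suc N choose Suc k) * (-1) ^ k / of_nat (Suc k)) =
      (\<Sum>k<K. of_nat (N choose k) / of_nat (Suc k) * (-1) ^ k) +
      (\<Sum>k<K. of_nat (N choose Suc k) * (-1) ^ k / of_nat (Suc k) :: 'a)"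
    by (simp add: sum.distrib [symmetric] add_divide_distrib ring_distribs del: of_nat_Suc)
  also have "(\<Sum>k<K. of_nat (N choose k) / of_nat (Suc k) * (-1) ^ k) =
      (\<Sum>k<K. of_nat (Suc N choose Suc k) * (-1) ^ k) / (of_nat (Suc N) :: 'a)"
    unfolding binomial_div_absorb sum_divide_distrib by simp
  also have "\<dots> = 1 / of_nat (Suc N)"
    using Suc.prems by (subst alternating_sum_binomial_Suc) auto
  finally show ?case
    using Suc by (simp add: harm_Suc inverse_eq_divide)
qed

text \<open>The value is the sum of \<open>1 / (i * j)\<close> over
  \<open>1 \<le> i \<le> j \<le> N\<close>; the increment collects the terms with
  \<open>j = Suc N\<close>.\<close>

lemma half_harm_square_Suc:
  "(harm (Suc N) ^ 2 + gen_harm 2 (Suc N)) / 2 =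
     (harm N ^ 2 + gen_harm 2 N) / 2 + harm (Suc N) / (of_nat (Suc N) :: 'a :: real_normed_field)"
proof -
  have "(of_nat (Suc N) :: 'a) \<noteq> 0"
    by (simp del: of_nat_Suc)
  then show ?thesis
    by (simp add: harm_Suc gen_harm_def field_simps power2_eq_square del: of_nat_Suc)
qed

text \<open>The previous induction one power higher. With \<open>N = n - p\<close> this evaluates
  the left-hand side at the node \<open>p\<close>.\<close>

lemma alternating_sum_binomial_div_square:
  assumes "N \<le> K"
  shows "(\<Sum>k<K. of_nat (N choose Suc k) * (-1) ^ k / of_nat (Suc k) ^ 2) =
           ((harm N ^ 2 + gen_harm 2 N) / 2 :: 'a :: real_normed_field)"
  using assms
proof (induction N)
  case 0
  then show ?case by (simp add: harm_def gen_harm_def)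
next
  case (Suc N)
  have "(\<Sum>k<K. of_nat (Suc N choose Suc k) * (-1) ^ k / of_nat (Suc k) ^ 2) =
      (\<Sum>k<K. of_nat (N choose k) / of_nat (Suc k) * (-1) ^ k / of_nat (Suc k)) +
      (\<Sum>k<K. of_nat (N choose Suc k) * (-1) ^ k / of_nat (Suc k) ^ 2 :: 'a)"
    by (simp add: sum.distrib [symmetric] add_divide_distrib ring_distribs power2_eq_square
        del: of_nat_Suc)
  also have "(\<Sum>k<K. of_nat (N choose k) / of_nat (Suc k) * (-1) ^ k / of_nat (Suc k)) =
      (\<Sum>k<K. of_nat (Suc N choose Suc k) * (-1) ^ k / of_nat (Suc k)) / (of_nat (Suc N) :: 'a)"
    unfolding binomial_div_absorb sum_divide_distrib by (simp add: mult.commute)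
  also have "\<dots> = harm (Suc N) / of_nat (Suc N)"
    using Suc.prems by (subst alternating_sum_binomial_div) auto
  finally show ?case
    using Suc by (simp add: half_harm_square_Suc del: of_nat_Suc)
qed

text \<open>This is \<open>w n k\<close> of the overview: minus the derivative of the Beta function
  in its first argument, at \<open>(k + 1, n - k)\<close>.\<close>

definition harm_beta :: "nat \<Rightarrow> nat \<Rightarrow> 'a :: real_normed_field" where
  "harm_beta n k = (harm n - harm k) / (of_nat (n - k) * of_nat (n choose k))"

text \<open>Under the integral this is \<open>u + (1 - u) = 1\<close>. The proof is algebraic
  instead: with \<open>n + 1 = a + d\<close>, both binomials of row \<open>n + 1\<close> are
  expressed through \<open>C\<close>, leaving a rational identity.\<close>

lemma harm_beta_Pascal:
  assumes "k < n"
  shows "harm_beta (Suc n) k + harm_beta (Suc n) (Suc k) = (harm_beta n k :: 'a :: real_normed_field)"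
proof -
  define C where "C = (of_nat (n choose k) :: 'a)"
  define d where "d = (of_nat (n - k) :: 'a)"
  define a where "a = (of_nat (Suc k) :: 'a)"
  have nz: "C \<noteq> 0" "d \<noteq> 0" "a \<noteq> 0" "a + d \<noteq> 0"
  proof -
    have "a + d = of_nat (Suc n)"
      unfolding a_def d_def of_nat_add [symmetric] using assms by simp
    then show "a + d \<noteq> 0" by (simp del: of_nat_Suc)
  qed (use assms in \<open>auto simp: C_def d_def a_def simp del: of_nat_Suc\<close>)
  have n: "of_nat (Suc n) = a + d"
    unfolding a_def d_def of_nat_add [symmetric] using assms by simp
  have "(Suc n - k) * (Suc n choose k) = Suc n * (n choose k)"
    using binomial_absorb_comp [of "Suc n" k] by (simp only: diff_Suc_1)
  then have 1: "of_nat (Suc n - k) * of_nat (Suc n choose k) = (a + d) * C"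
    unfolding n [symmetric] C_def of_nat_mult [symmetric] by (simp only:)
  have "a * of_nat (Suc n choose Suc k) = (a + d) * C"
    unfolding n [symmetric] unfolding C_def a_def of_nat_mult [symmetric]
    by (simp only: Suc_times_binomial)
  then have 2: "of_nat (Suc n choose Suc k) = (a + d) * C / a"
    using nz(3) by (metis nonzero_mult_div_cancel_left)
  have 3: "(harm (Suc n) :: 'a) = harm n + 1 / (a + d)" "(harm (Suc k) :: 'a) = harm k + 1 / a"
    by (simp_all add: harm_Suc inverse_eq_divide n a_def del: of_nat_Suc)
  show ?thesis
    unfolding harm_beta_def 1 2 3 diff_Suc_Suc d_def [symmetric] C_def [symmetric]
    using nz by (simp add: divide_simps) (simp add: algebra_simps)
qed

text \<open>Each use of the Pascal-type rule lowers \<open>p\<close> and \<open>n\<close> together,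
  ending at \<open>harm_beta (n - p) 0\<close>.\<close>

lemma sum_binomial_harm_beta:
  assumes "p < n"
  shows "(\<Sum>k\<le>p. of_nat (p choose k) * harm_beta n k) =
           (harm (n - p) / of_nat (n - p) :: 'a :: real_normed_field)"
  using assms
proof (induction p arbitrary: n)
  case 0
  then show ?case by (simp add: harm_beta_def harm_def)
next
  case (Suc p)
  then obtain m where n: "n = Suc m" "p < m"
    by (cases n) auto
  have "(\<Sum>k\<le>Suc p. of_nat (Suc p choose k) * harm_beta n k :: 'a) =
      harm_beta n 0 + (\<Sum>k\<le>p. of_nat (p choose Suc k) * harm_beta n (Suc k)) +
      (\<Sum>k\<le>p. of_nat (p choose k) * harm_beta n (Suc k))"
    by (subst sum.atMost_Suc_shift) (simp add: sum.distrib ring_distribs)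
  \<comment> \<open>Shifting back creates a top term with coefficient \<open>p choose Suc p\<close>,
    which is zero.\<close>
  also have "harm_beta n 0 + (\<Sum>k\<le>p. of_nat (p choose Suc k) * harm_beta n (Suc k)) =
      (\<Sum>k\<le>Suc p. of_nat (p choose k) * harm_beta n k :: 'a)"
    by (subst sum.atMost_Suc_shift) simp
  also have "\<dots> = (\<Sum>k\<le>p. of_nat (p choose k) * harm_beta n k)"
    by simp
  also have "\<dots> + (\<Sum>k\<le>p. of_nat (p choose k) * harm_beta n (Suc k)) =
      (\<Sum>k\<le>p. of_nat (p choose k) * harm_beta m k)"
    unfolding sum.distrib [symmetric] n(1)
    by (intro sum.cong refl, subst harm_beta_Pascal [symmetric])
      (use n in \<open>auto simp: ring_distribs\<close>)
  also have "\<dots> = harm (n - Suc p) / of_nat (n - Suc p)"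
    using Suc.IH [OF n(2)] n(1) by simp
  finally show ?case .
qed

text \<open>The right-hand side at the node \<open>p\<close>: passing from \<open>p\<close> to
  \<open>Suc p\<close> lowers both sides by \<open>harm (n - p) / (n - p)\<close>.\<close>

lemma sum_binomial_Suc_harm_beta:
  assumes "p \<le> n"
  shows "((harm (n - p) ^ 2 + gen_harm 2 (n - p)) / 2 :: 'a :: real_normed_field) =
           (harm n ^ 2 + gen_harm 2 n) / 2 - (\<Sum>k<n. of_nat (p choose Suc k) * harm_beta n k)"
  using assms
proof (induction p)
  case 0
  then show ?case by simp
next
  case (Suc p)
  have "(\<Sum>k<n. of_nat (p choose k) * harm_beta n k) = 
      (\<Sum>k\<le>p. of_nat (p choose k) * harm_beta n k :: 'a)"
    using Suc.prems by (intro sum.mono_neutral_right) auto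
  also have "\<dots> = harm (n - p) / of_nat (n - p)"
    using Suc.prems by (intro sum_binomial_harm_beta) auto
  finally have "(\<Sum>k<n. of_nat (Suc p choose Suc k) * harm_beta n k :: 'a) =
      harm (n - p) / of_nat (n - p) + (\<Sum>k<n. of_nat (p choose Suc k) * harm_beta n k)"
    by (simp add: sum.distrib ring_distribs)
  moreover have "n - p = Suc (n - Suc p)"
    using Suc.prems by simp
  then have "((harm (n - Suc p) ^ 2 + gen_harm 2 (n - Suc p)) / 2 :: 'a) =
      (harm (n - p) ^ 2 + gen_harm 2 (n - p)) / 2 - harm (n - p) / of_nat (n - p)"
    by (simp only: half_harm_square_Suc add_diff_cancel_right')
  ultimately show ?case
    using Suc by (simp only: Suc_leD diff_diff_eq add.commute)
qed

text \<open>The affine argument serves both sides of the identity, as \<open>n - x\<close> and as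
  \<open>x\<close>.\<close>

lemma gbinomial_linear_poly:
  fixes a b :: "'a :: field_char_0"
  shows "\<exists>q. degree q \<le> k \<and> (\<forall>x. poly q x = (a + b * x) gchoose k)"
proof (intro exI conjI allI)
  let ?q = "smult (1 / fact k) (\<Prod>i<k. [:a - of_nat i, b:])"
  have "degree (\<Prod>i<k. [:a - of_nat i, b:]) \<le> (\<Sum>i<k. degree [:a - of_nat i, b:])"
    using degree_prod_sum_le [of "{..<k}" "\<lambda>i. [:a - of_nat i, b:]"] by (simp only: comp_def finite_lessThan)
  also have "\<dots> \<le> (\<Sum>i<k. 1)"
    by (intro sum_mono) simp
  finally show "degree ?q \<le> k"
    by (simp add: order.trans [OF degree_smult_le])
  show "poly ?q x = (a + b * x) gchoose k" for x
    by (simp add: poly_prod gbinomial_prod_rev atLeast0LessThan algebra_simps)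
qed

lemma sum_gbinomial_linear_poly:
  fixes a b :: "'a :: field_char_0"
  assumes "finite A" "\<And>k. k \<in> A \<Longrightarrow> f k \<le> n"
  shows "\<exists>q. degree q \<le> n \<and> (\<forall>x. poly q x = (\<Sum>k\<in>A. ((a + b * x) gchoose f k) * c k))"
proof -
  obtain Q where Q: "\<And>k. degree (Q k) \<le> k" "\<And>k x. poly (Q k) x = (a + b * x) gchoose k"
    using gbinomial_linear_poly [of _ a b] by metis
  show ?thesis
  proof (intro exI conjI allI)
    show "degree (\<Sum>k\<in>A. smult (c k) (Q (f k))) \<le> n"
      using assms Q(1) by (intro degree_sum_le) (auto intro: order.trans [OF degree_smult_le] order.trans)
    show "poly (\<Sum>k\<in>A. smult (c k) (Q (f k))) x = (\<Sum>k\<in>A. ((a + b * x) gchoose f k) * c k)" for x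
      by (simp add: poly_sum Q(2) mult.commute)
  qed
qed

lemma poly_eqI_on_nats:
  fixes P Q :: "'a :: {idom, ring_char_0} poly"
  assumes "degree P \<le> n" "degree Q \<le> n"
    and "\<And>p. p \<le> n \<Longrightarrow> poly P (of_nat p) = poly Q (of_nat p)"
  shows "P = Q"
proof (rule poly_eqI_degree)
  show "poly P x = poly Q x" if "x \<in> of_nat ` {..n}" for x
    using that assms(3) by auto
  have "card (of_nat ` {..n} :: 'a set) = Suc n"
    by (simp add: card_image inj_on_def)
  then show "degree P < card (of_nat ` {..n} :: 'a set)" "degree Q < card (of_nat ` {..n} :: 'a set)"
    using assms(1,2) by auto
qed

lemma sum_gbinomial_div_square:
  fixes x :: "'a :: real_normed_field"
  shows "(\<Sum>k<n. ((of_nat n - x) gchoose Suc k) * ((-1) ^ k / of_nat (Suc k) ^ 2)) =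
           (harm n ^ 2 + gen_harm 2 n) / 2 - (\<Sum>k<n. (x gchoose Suc k) * harm_beta n k)"
proof -
  obtain P where P: "degree P \<le> n"
    "\<And>x. poly P x = (\<Sum>k<n. ((of_nat n - x) gchoose Suc k) * ((-1) ^ k / of_nat (Suc k) ^ 2) :: 'a)"
    using sum_gbinomial_linear_poly [of "{..<n}" Suc n "of_nat n" "-1"
        "\<lambda>k. (-1) ^ k / of_nat (Suc k) ^ 2 :: 'a"] by auto
  obtain Q where Q: "degree Q \<le> n"
    "\<And>x. poly Q x = (\<Sum>k<n. (x gchoose Suc k) * harm_beta n k :: 'a)"
    using sum_gbinomial_linear_poly [of "{..<n}" Suc n 0 1 "harm_beta n :: _ \<Rightarrow> 'a"] by auto
  let ?R = "[:(harm n ^ 2 + gen_harm 2 n) / 2:] - Q"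
  have "P = ?R"
  proof (rule poly_eqI_on_nats)
    show "degree ?R \<le> n"
      by (intro degree_diff_le Q) simp
    fix p assume p: "p \<le> n"
    then have "poly P (of_nat p) = (harm (n - p) ^ 2 + gen_harm 2 (n - p)) / 2"
      using alternating_sum_binomial_div_square [of "n - p" n, where 'a = 'a]
      by (simp add: P of_nat_diff [symmetric] binomial_gbinomial [symmetric] del: of_nat_Suc of_nat_diff)
    then show "poly P (of_nat p) = poly ?R (of_nat p)"
      using sum_binomial_Suc_harm_beta [OF p, where 'a = 'a]
      by (simp add: Q binomial_gbinomial [symmetric] del: of_nat_Suc)
  qed (rule P)
  then show ?thesis
    using P(2) [of x] Q(2) [of x] by simp
qed

text \<open>Absorption yields the factor \<open>s\<close>, and negating the upper index yields the
  sign.\<close>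

lemma gbinomial_uminus_Suc:
  fixes s :: "'a :: field_char_0"
  shows "(- s) gchoose Suc k = - (s * ((-1) ^ k / of_nat (Suc k) * ((s + of_nat k) gchoose k)))"
proof -
  have "of_nat (Suc k) * ((- s) gchoose Suc k) = - s * ((- s - 1) gchoose k)"
    by (rule gbinomial_absorption)
  also have "(- s - 1) gchoose k = (-1) ^ k * ((s + of_nat k) gchoose k)"
    by (subst gbinomial_negated_upper) (simp add: algebra_simps)
  finally show ?thesis
    by (simp add: field_simps del: of_nat_Suc)
qed

theorem theorem2p9:
  fixes n :: nat and s :: complex
  assumes "n \<ge> 1"
    and "s \<notin> {- of_nat j | j :: nat. j \<ge> 1}"
  shows "(\<Sum>k=1..n. ((s + of_nat n) gchoose k) * ((-1) ^ (k - 1) / of_nat k ^ 2)) =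
         (harm n ^ 2 + gen_harm 2 n) / 2
         + s * (\<Sum>k=0..n-1. (-1) ^ k / of_nat (k + 1) * ((s + of_nat k) gchoose k)
                 * ((harm n - harm k) / (of_nat (n - k) * of_nat (n choose k))))"
proof -
  \<comment> \<open>Truncated subtraction makes \<open>n \<ge> 1\<close> essential: for
    \<open>n = 0\<close> the left set is \<open>{0}\<close>.\<close>
  have "{0..n-1} = {..<n}"
    using assms(1) by auto
  then have *: "s * (\<Sum>k=0..n-1. (-1) ^ k / of_nat (k + 1) * ((s + of_nat k) gchoose k)
                 * ((harm n - harm k) / (of_nat (n - k) * of_nat (n choose k)))) =
      - (\<Sum>k<n. ((- s) gchoose Suc k) * harm_beta n k)"
    by (simp add: gbinomial_uminus_Suc harm_beta_def sum_distrib_left sum_negf mult.assoc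
        del: of_nat_Suc)
  \<comment> \<open>The double negation exhibits the substitution \<open>x = - s\<close>.\<close>
  have "(\<Sum>k=1..n. ((s + of_nat n) gchoose k) * ((-1) ^ (k - 1) / of_nat k ^ 2)) =
      (\<Sum>k<n. ((of_nat n - - s) gchoose Suc k) * ((-1) ^ k / of_nat (Suc k) ^ 2))"
    by (rule sum.reindex_bij_witness [of _ Suc "\<lambda>k. k - 1"])
      (auto simp: add.commute simp del: of_nat_Suc)
  then show ?thesis
    unfolding * sum_gbinomial_div_square by simp
qed

end
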